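(* Let $S_{\rm lcm}(n)$ denote the set of permutations $\pi$ of $[n]=\{1,2,\dots,n\}$ such that $\operatorname{lcm}[j,\pi(j)]\le n$ for every $j\in[n]$. Then $\#S_{\rm lcm}(n)\le e^{2.61n}$ for all sufficiently large $n$. *)

theory Defs
  imports Complex_Main "HOL-Combinatorics.Permutations"
begin

definition S_lcm :: "nat \<Rightarrow> (nat \<Rightarrow> nat) set" where
  "S_lcm n = {\<pi>. \<pi> permutes {1..n} \<and> (\<forall>j\<in>{1..n}. lcm j (\<pi> j) \<le> n)}"

end

theory Submission
  imports Defs "HOL-Library.FuncSet"
begin

text \<open>
  Since \<open>\<pi>\<close> is a bijection, \<open>\<Prod>j. \<pi>(j)/j = 1\<close>, so the number of admissible permutations equals the
  permanent of the matrix with entry \<open>k/j\<close> when \<open>lcm[j,k] \<le> n\<close> and \<open>0\<close> otherwise, and this permanent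
  is at most the product of the row sums. Writing \<open>k/j = b/a\<close> in lowest terms, \<open>a\<close> divides \<open>j\<close> and
  \<open>b = lcm[j,k]/j \<le> n/j\<close>, so row \<open>j\<close> sums to at most \<open>(n/j)\<^sup>2 s(j)\<close>, where \<open>s(j) = \<Sum>a | j. 1/a\<close>.
  Now \<open>\<Prod>j. (n/j)\<^sup>2 = (n^n/n!)\<^sup>2 \<le> e^(2n)\<close>, while the mean of \<open>s\<close> over \<open>[n]\<close> is at most
  \<open>\<Sum>a. 1/a\<^sup>2 \<le> 7/4 < e^0.61\<close>, so \<open>\<Prod>j. s(j) \<le> e^(0.61n)\<close> by the inequality of arithmetic and
  geometric means.
\<close>

text \<open>Each admissible permutation has weight 1, since numerators and denominators run over the
  same values of \<open>f\<close>. Dropping injectivity only adds nonnegative terms, and the sum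
  over all choice functions factors into row sums.\<close>

lemma card_restricted_permutations_le:
  fixes f :: "'a \<Rightarrow> real"
  assumes fin: "finite A" and pos: "\<And>x. x \<in> A \<Longrightarrow> f x > 0"
  shows "real (card {\<pi>. \<pi> permutes A \<and> (\<forall>x\<in>A. M x (\<pi> x))})
           \<le> (\<Prod>x\<in>A. \<Sum>y | y \<in> A \<and> M x y. f y / f x)"
proof -
  define P where "P = {\<pi>. \<pi> permutes A \<and> (\<forall>x\<in>A. M x (\<pi> x))}"
  define B where "B x = {y. y \<in> A \<and> M x y}" for x
  have one: "(\<Prod>x\<in>A. f (restrict \<pi> A x) / f x) = 1" if "\<pi> \<in> P" for \<pi>
  proof -
    have perm: "\<pi> permutes A" using that by (simp add: P_def)
    have "(\<Prod>x\<in>A. f (\<pi> x)) = (\<Prod>x\<in>A. f x)"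
      using prod.permute[OF perm, of f] by (simp add: o_def)
    moreover have "(\<Prod>x\<in>A. f x) > 0" using pos by (simp add: prod_pos)
    ultimately show ?thesis by (simp add: prod_dividef)
  qed
  \<comment> \<open>Permutations are the identity off \<open>A\<close>, members of
    \<open>PiE A B\<close> are \<open>undefined\<close> there; restricting passes from one
    convention to the other without losing information.\<close>
  have inj: "inj_on (\<lambda>\<pi>. restrict \<pi> A) P"
  proof (rule inj_onI)
    fix \<pi> \<sigma> assume *: "\<pi> \<in> P" "\<sigma> \<in> P" "restrict \<pi> A = restrict \<sigma> A"
    have "\<pi> x = \<sigma> x" for x
    proof (cases "x \<in> A")
      case True
      then show ?thesis using fun_cong[OF *(3), of x] by simp
    next
      case False
      then show ?thesis using * by (simp add: P_def permutes_def)
    qed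
    then show "\<pi> = \<sigma>" by blast
  qed
  have sub: "(\<lambda>\<pi>. restrict \<pi> A) ` P \<subseteq> PiE A B"
    by (auto simp: P_def B_def PiE_def permutes_in_image)
  have finB: "finite (B x)" for x using fin by (simp add: B_def)
  have "real (card P) = (\<Sum>\<pi>\<in>P. \<Prod>x\<in>A. f (restrict \<pi> A x) / f x)"
    using one by (simp cong: sum.cong)
  also have "\<dots> = (\<Sum>g\<in>(\<lambda>\<pi>. restrict \<pi> A) ` P. \<Prod>x\<in>A. f (g x) / f x)"
    by (simp only: sum.reindex[OF inj] o_def)
  also have "\<dots> \<le> (\<Sum>g\<in>PiE A B. \<Prod>x\<in>A. f (g x) / f x)"
  proof (rule sum_mono2[OF _ sub])
    show "finite (PiE A B)" using fin finB by (simp add: finite_PiE)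
    fix g assume "g \<in> PiE A B - (\<lambda>\<pi>. restrict \<pi> A) ` P"
    then have "g x \<in> A" if "x \<in> A" for x using that by (auto simp: B_def PiE_def Pi_def)
    then show "0 \<le> (\<Prod>x\<in>A. f (g x) / f x)"
      using pos by (intro prod_nonneg) (simp add: less_imp_le)
  qed
  also have "\<dots> = (\<Prod>x\<in>A. \<Sum>y\<in>B x. f y / f x)"
    using prod_sum_PiE[OF fin finB, of "\<lambda>x y. f y / f x"] by simp
  finally show ?thesis by (simp add: P_def B_def)
qed

lemma lcm_row_sum_le:
  fixes j n :: nat
  assumes j: "j \<in> {1..n}"
  shows "(\<Sum>k | k \<in> {1..n} \<and> lcm j k \<le> n. real k / real j)
           \<le> (real n / real j)\<^sup>2 * (\<Sum>a | a dvd j. 1 / real a)"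
proof -
  define K where "K = {k. k \<in> {1..n} \<and> lcm j k \<le> n}"
  define h where "h k = (j div gcd j k, k div gcd j k)" for k
  define m where "m = n div j"
  have j0: "j > 0" using j by simp
  \<comment> \<open>\<open>h k\<close> is the fraction k/j in lowest terms, denominator first; with
    \<open>j\<close> fixed it determines \<open>k\<close>.\<close>
  have ratio: "real k / real j = real (snd (h k)) / real (fst (h k))" for k
    using j0 by (simp add: h_def real_of_nat_div)
  have inj: "inj_on h K"
  proof (rule inj_onI)
    fix k l assume "h k = h l"
    then have "real k / real j = real l / real j" by (simp only: ratio)
    then show "k = l" using j0 by simp
  qed
  have sub: "h ` K \<subseteq> {a. a dvd j} \<times> {1..m}"
  proof
    fix p assume "p \<in> h ` K"
    then obtain k where k: "k \<in> {1..n}" "lcm j k \<le> n" "p = h k" by (auto simp: K_def)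
    have "lcm j k = (k div gcd j k) * j"
      by (metis div_mult_swap gcd_dvd2 lcm_nat_def mult.commute)
    then have "k div gcd j k \<le> m"
      using k(2) j0 by (simp add: m_def less_eq_div_iff_mult_less_eq)
    moreover have "k div gcd j k \<ge> 1"
      using k(1) j0 by (simp add: Suc_le_eq div_greater_zero_iff gcd_le2_nat)
    moreover have "j div gcd j k dvd j"
      by (metis dvd_def dvd_div_mult_self gcd_dvd1)
    ultimately show "p \<in> {a. a dvd j} \<times> {1..m}" by (simp add: k(3) h_def)
  qed
  have fin: "finite {a. a dvd j}" using j0 by simp
  have "(\<Sum>k\<in>K. real k / real j) = (\<Sum>p\<in>h ` K. real (snd p) / real (fst p))"
    by (simp add: sum.reindex[OF inj] ratio)
  also have "\<dots> \<le> (\<Sum>p\<in>{a. a dvd j} \<times> {1..m}. real (snd p) / real (fst p))"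
    using fin by (intro sum_mono2 sub) auto
  also have "\<dots> = (\<Sum>a | a dvd j. \<Sum>b=1..m. real b * (1 / real a))"
    by (simp add: sum.cartesian_product split_def)
  also have "\<dots> = (\<Sum>b=1..m. real b) * (\<Sum>a | a dvd j. 1 / real a)"
    by (simp only: sum_distrib_right[symmetric] sum_distrib_left[symmetric])
  also have "\<dots> \<le> (real n / real j)\<^sup>2 * (\<Sum>a | a dvd j. 1 / real a)"
  proof (rule mult_right_mono)
    \<comment> \<open>Each of the \<open>m\<close> terms is at most \<open>m\<close>; this is sharp
      at m = 1, that is, for j > n/2.\<close>
    have "(\<Sum>b=1..m. real b) \<le> (\<Sum>b=1..m. real m)" by (intro sum_mono) simp
    also have "\<dots> = (real m)\<^sup>2" by (simp add: power2_eq_square)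
    also have "\<dots> \<le> (real n / real j)\<^sup>2"
      by (intro power_mono) (simp_all add: m_def of_nat_div_le_of_nat)
    finally show "(\<Sum>b=1..m. real b) \<le> (real n / real j)\<^sup>2" .
  qed (simp add: sum_nonneg)
  finally show ?thesis by (simp add: K_def)
qed

text \<open>The left side is a single term of the exponential series, whose terms are all
  nonnegative.\<close>

lemma power_div_fact_le_exp:
  fixes x :: real
  assumes "x \<ge> 0"
  shows "x ^ n / fact n \<le> exp x"
  using sum_le_suminf[OF summable_exp[of x], of "{n}"] assms
  by (simp add: exp_def divide_inverse mult.commute)

lemma prod_n_div_le_exp: "(\<Prod>j=1..n. real n / real j) \<le> exp (real n)"
proof -
  have "(\<Prod>j=1..n. real n / real j) = real n ^ n / fact n"
    by (simp add: prod_dividef fact_prod)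
  then show ?thesis using power_div_fact_le_exp[of "real n" n] by simp
qed

lemma sum_inverse_squares_le: "(\<Sum>a=1..n. 1 / (real a)\<^sup>2) \<le> 7 / 4"
proof -
  \<comment> \<open>The correction 1/n absorbs the telescoping bound on the next term. Equality at n
    = 2 gives 7/4; starting at n = 1 would give 2, which exceeds e^0.61.\<close>
  have "(\<Sum>a=1..n. 1 / (real a)\<^sup>2) \<le> 7 / 4 - 1 / real n" if "n \<ge> 2" for n
    using that
  proof (induction n rule: dec_induct)
    case base
    show ?case by (simp add: numeral_2_eq_2)
  next
    case (step n)
    have "1 / (real (Suc n))\<^sup>2 \<le> 1 / (real n * real (Suc n))"
      using step.hyps by (intro divide_left_mono) (auto simp: power2_eq_square)
    also have "\<dots> = 1 / real n - 1 / real (Suc n)"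
      using step.hyps by (simp add: field_simps)
    finally show ?case using step.IH by simp
  qed
  from this[of n] consider "n = 0" | "n = 1" | "(\<Sum>a=1..n. 1 / (real a)\<^sup>2) \<le> 7 / 4 - 1 / real n"
    by linarith
  then show ?thesis
  proof cases
    case 3
    then show ?thesis using divide_nonneg_nonneg[of 1 "real n"] by linarith
  qed auto
qed

lemma card_multiples_le: "a > 0 \<Longrightarrow> card {j \<in> {1..n}. a dvd j} \<le> n div a" for a n :: nat
proof -
  assume a: "a > 0"
  have "{j \<in> {1..n}. a dvd j} \<subseteq> (\<lambda>i. a * i) ` {1..n div a}"
    using a by (auto simp: less_eq_div_iff_mult_less_eq mult.commute elim!: dvdE)
  from card_mono[OF _ this] card_image_le[of "{1..n div a}" "\<lambda>i. a * i"]
  show ?thesis by simp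
qed

text \<open>After swapping the sums, each \<open>a\<close> has at most n/a multiples up to
  \<open>n\<close>, each of weight 1/a, so it contributes at most n/a^2.\<close>

lemma sum_inverse_divisors_le: "(\<Sum>j=1..n. \<Sum>a | a dvd j. 1 / real a) \<le> 7 / 4 * real n"
proof -
  have "(\<Sum>j=1..n. \<Sum>a | a dvd j. 1 / real a) = (\<Sum>j=1..n. \<Sum>a | a \<in> {1..n} \<and> a dvd j. 1 / real a)"
    by (intro sum.cong) (auto dest: dvd_imp_le dvd_pos_nat simp: Suc_le_eq)
  also have "\<dots> = (\<Sum>a=1..n. \<Sum>j | j \<in> {1..n} \<and> a dvd j. 1 / real a)"
    by (intro sum.swap_restrict) auto
  also have "\<dots> \<le> (\<Sum>a=1..n. real n * (1 / (real a)\<^sup>2))"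
  proof (intro sum_mono)
    fix a assume a: "a \<in> {1..n}"
    have "real (card {j \<in> {1..n}. a dvd j}) \<le> real n / real a"
      using card_multiples_le[of a n] a of_nat_div_le_of_nat[of n a, where 'a = real] by simp
    then have "real (card {j \<in> {1..n}. a dvd j}) * (1 / real a) \<le> real n / real a * (1 / real a)"
      by (intro mult_right_mono) auto
    then show "(\<Sum>j | j \<in> {1..n} \<and> a dvd j. 1 / real a) \<le> real n * (1 / (real a)\<^sup>2)"
      by (simp add: power2_eq_square)
  qed
  also have "\<dots> = real n * (\<Sum>a=1..n. 1 / (real a)\<^sup>2)"
    by (simp only: sum_distrib_left)
  also have "\<dots> \<le> real n * (7 / 4)"
    by (intro mult_left_mono sum_inverse_squares_le) simp
  finally show ?thesis by simp
qed

text \<open>AM-GM via t \<le> e^(t-1) at t = f(x)/c: the exponents f(x)/c - 1 sum to at most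
  0.\<close>

lemma prod_le_power_of_sum_le:
  fixes f :: "'a \<Rightarrow> real"
  assumes "finite A" "c > 0" "\<And>x. x \<in> A \<Longrightarrow> f x \<ge> 0" "sum f A \<le> c * real (card A)"
  shows "prod f A \<le> c ^ card A"
proof -
  have "(\<Prod>x\<in>A. f x / c) \<le> (\<Prod>x\<in>A. exp (f x / c - 1))"
    using assms exp_ge_add_one_self[of "f x / c - 1" for x] by (intro prod_mono) auto
  also have "\<dots> = exp (sum f A / c - real (card A))"
    using assms(1) by (simp add: exp_sum[symmetric] sum_subtractf sum_divide_distrib)
  also have "\<dots> \<le> 1"
    using assms(2,4) by (simp add: field_simps)
  finally show ?thesis using assms(2) by (simp add: prod_dividef field_simps)
qed

lemma card_S_lcm_le: "real (card (S_lcm n)) \<le> exp (2.61 * real n)"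
proof -
  define s where "s j = (\<Sum>a | a dvd j. 1 / real a)" for j :: nat
  have s_nonneg: "s j \<ge> 0" for j by (simp add: s_def sum_nonneg)
  have "real (card (S_lcm n)) \<le> (\<Prod>j=1..n. \<Sum>k | k \<in> {1..n} \<and> lcm j k \<le> n. real k / real j)"
    using card_restricted_permutations_le[of "{1..n}" real "\<lambda>j k. lcm j k \<le> n"]
    by (simp add: S_lcm_def)
  also have "\<dots> \<le> (\<Prod>j=1..n. (real n / real j)\<^sup>2 * s j)"
    unfolding s_def by (intro prod_mono conjI sum_nonneg lcm_row_sum_le) auto
  also have "\<dots> = (\<Prod>j=1..n. real n / real j)\<^sup>2 * (\<Prod>j=1..n. s j)"
    by (simp only: prod.distrib prod_power_distrib)
  also have "\<dots> \<le> (exp (real n))\<^sup>2 * (7 / 4) ^ n"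
  proof (intro mult_mono power_mono prod_n_div_le_exp)
    show "(\<Prod>j=1..n. s j) \<le> (7 / 4) ^ n"
      using prod_le_power_of_sum_le[of "{1..n}" "7 / 4" s] sum_inverse_divisors_le[of n] s_nonneg
      by (simp add: s_def)
  qed (auto intro: prod_nonneg s_nonneg)
  also have "\<dots> \<le> (exp (real n))\<^sup>2 * exp 0.61 ^ n"
  proof (intro mult_left_mono power_mono)
    \<comment> \<open>The quadratic Taylor bound is 1 + 0.61 + 0.61^2/2 = 1.79605.\<close>
    show "7 / 4 \<le> exp (0.61 :: real)"
      using exp_lower_Taylor_quadratic[of "0.61"] by (simp add: power2_eq_square)
  qed auto
  also have "\<dots> = exp (2.61 * real n)"
    by (simp add: exp_of_nat_mult[symmetric] exp_add[symmetric] power2_eq_square algebra_simps)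
  finally show ?thesis .
qed

theorem theorem1:
  shows "\<forall>\<^sub>F n :: nat in sequentially. real (card (S_lcm n)) \<le> exp (2.61 * real n)"
  by (rule always_eventually) (simp only: card_S_lcm_le simp_thms)

end
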